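(* Let $\mathcal{G}$ be a hereditary class of graphs such that every graph in $\mathcal{G}$ is $2K_2$-free. If every prime graph in $\mathcal{G}$ is recolorable, then every graph in $\mathcal{G}$ is recolorable.
   Context: Graphs are finite and simple. A class is hereditary if closed under induced subgraphs. $2K_2$ is the disjoint union of two edges; a graph is $2K_2$-free if it has no induced $2K_2$. A $k$-coloring of $G$ is a map $V(G)\to\{1,\dots,k\}$ giving adjacent vertices different colors; $\chi(G)$ is the chromatic number. $R_\ell(G)$ is the graph whose vertices are the $\ell$-colorings of $G$, two adjacent if they differ on exactly one vertex. $G$ is recolorable if $R_\ell(G)$ is connected for every $\ell\ge\chi(G)+1$. A module is a non-empty $S\subseteq V(G)$ such that every vertex outside $S$ is adjacent to all or none of $S$; it is non-trivial if it is a proper subset of $V(G)$ with at least two vertices; $G$ is prime if it has no non-trivial module. *)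

theory Defs
  imports "Graph_Theory.Digraph_Isomorphism" "HOL-Library.FuncSet"
begin

text \<open>
  Finite simple graphs are the finite loop-free symmetric digraphs of locale
  \<^locale>\<open>pair_graph\<close>: every undirected edge is represented by its two orientations.
  The null graph is allowed; it is prime and recolorable.
\<close>

definition hereditary :: "'a pair_pre_digraph set \<Rightarrow> bool" where
  "hereditary \<G> \<longleftrightarrow>
     (\<forall>G \<in> \<G>. \<forall>H. induced_subgraph (with_proj H) (with_proj G) \<longrightarrow> H \<in> \<G>)"

definition two_K2 :: "nat pair_pre_digraph" where
  "two_K2 = \<lparr> pverts = {0, 1, 2, 3}, parcs = {(0, 1), (1, 0), (2, 3), (3, 2)} \<rparr>"

definition two_K2_free :: "'a pair_pre_digraph \<Rightarrow> bool" where
  "two_K2_free G \<longleftrightarrow>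
     \<not> (\<exists>H. induced_subgraph (with_proj H) (with_proj G) \<and>
          digraph_iso (with_proj two_K2) (with_proj H))"

text \<open>Colorings are extensional, so two colorings of \<open>G\<close> are equal iff they agree on the
  vertices of \<open>G\<close>.\<close>

definition colorings :: "'a pair_pre_digraph \<Rightarrow> nat \<Rightarrow> ('a \<Rightarrow> nat) set" where
  "colorings G k = {c \<in> pverts G \<rightarrow>\<^sub>E {1..k}. \<forall>(u, v) \<in> parcs G. c u \<noteq> c v}"

definition chromatic_number :: "'a pair_pre_digraph \<Rightarrow> nat" where
  "chromatic_number G = (LEAST k. colorings G k \<noteq> {})"

definition recoloring_graph :: "'a pair_pre_digraph \<Rightarrow> nat \<Rightarrow> ('a \<Rightarrow> nat) pair_pre_digraph" where
  "recoloring_graph G l =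
     \<lparr> pverts = colorings G l,
       parcs = {(c, d) \<in> colorings G l \<times> colorings G l. \<exists>!v. v \<in> pverts G \<and> c v \<noteq> d v} \<rparr>"

definition recolorable :: "'a pair_pre_digraph \<Rightarrow> bool" where
  "recolorable G \<longleftrightarrow> (\<forall>l \<ge> chromatic_number G + 1. connected (with_proj (recoloring_graph G l)))"

definition is_module :: "'a pair_pre_digraph \<Rightarrow> 'a set \<Rightarrow> bool" where
  "is_module G S \<longleftrightarrow> S \<noteq> {} \<and> S \<subseteq> pverts G \<and>
     (\<forall>v \<in> pverts G - S. (\<forall>s \<in> S. (v, s) \<in> parcs G) \<or> (\<forall>s \<in> S. (v, s) \<notin> parcs G))"

definition nontrivial_module :: "'a pair_pre_digraph \<Rightarrow> 'a set \<Rightarrow> bool" where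
  "nontrivial_module G S \<longleftrightarrow> is_module G S \<and> S \<subset> pverts G \<and> card S \<ge> 2"

definition prime_graph :: "'a pair_pre_digraph \<Rightarrow> bool" where
  "prime_graph G \<longleftrightarrow> \<not> (\<exists>S. nontrivial_module G S)"

end

theory Submission
  imports Defs
begin

text \<open>
  Induct on the number of vertices. If \<open>u\<close> and \<open>v\<close> are non-adjacent and every neighbour of \<open>u\<close> is a
  neighbour of \<open>v\<close>, recolor \<open>u\<close> with the color of \<open>v\<close>; from then on \<open>u\<close> follows \<open>v\<close> along any
  recoloring sequence of \<open>G - u\<close>. Suppose there is no such pair and let \<open>S\<close> be a non-trivial
  module. Two vertices of an independent module would form such a pair, so \<open>S\<close> spans an edge.
  Since \<open>G\<close> is \<open>2K\<^sub>2\<close>-free, the vertices outside \<open>S\<close> without neighbour in \<open>S\<close> are independent, so each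
  would form such a pair with any vertex of \<open>S\<close>. Hence there are none, and \<open>G\<close> is the join of \<open>S\<close> and
  its complement. In a join the two sides use disjoint sets of colors, and with more than
  \<open>\<chi>(S) + \<chi>(B)\<close> colors one side always has a color to spare; this lets the set of colors
  used on \<open>S\<close> be exchanged one color at a time for any prescribed set of size \<open>\<chi>(S)\<close>.
\<close>

section \<open>Colorings with an arbitrary set of colors\<close>

text \<open>The color set is arbitrary because each side of a join is recolored inside its own set
  of colors, which need not be an initial segment.\<close>

definition proper_colorings :: "'a pair_pre_digraph \<Rightarrow> nat set \<Rightarrow> ('a \<Rightarrow> nat) set" where
  "proper_colorings G C = {c \<in> pverts G \<rightarrow>\<^sub>E C. \<forall>(u, v) \<in> parcs G. c u \<noteq> c v}"

text \<open>The new color \<open>x\<close> may equal the old one, so the relation is reflexive on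
  colorings; its reflexive transitive closure is the same as without trivial steps.\<close>

definition recolorings :: "'a pair_pre_digraph \<Rightarrow> nat set \<Rightarrow> ('a \<Rightarrow> nat) rel" where
  "recolorings G C = {(c, d). c \<in> proper_colorings G C \<and> d \<in> proper_colorings G C \<and>
     (\<exists>v \<in> pverts G. \<exists>x. d = c(v := x))}"

definition induced :: "'a pair_pre_digraph \<Rightarrow> 'a set \<Rightarrow> 'a pair_pre_digraph" where
  "induced G S = \<lparr> pverts = S, parcs = parcs G \<inter> S \<times> S \<rparr>"

lemma induced_simps [simp]:
  "pverts (induced G S) = S" "parcs (induced G S) = parcs G \<inter> S \<times> S"
  by (simp_all add: induced_def)

lemma colorings_eq: "colorings G k = proper_colorings G {1..k}"
  by (simp add: colorings_def proper_colorings_def)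

lemma proper_coloringsD:
  assumes "c \<in> proper_colorings G C"
  shows "v \<in> pverts G \<Longrightarrow> c v \<in> C" "v \<notin> pverts G \<Longrightarrow> c v = undefined"
    "(u, v) \<in> parcs G \<Longrightarrow> c u \<noteq> c v"
  using assms by (auto simp: proper_colorings_def dest: PiE_arb)

lemma pair_graphD:
  assumes "pair_graph G"
  shows "finite (pverts G)" "(u, v) \<in> parcs G \<Longrightarrow> u \<in> pverts G"
    "(u, v) \<in> parcs G \<Longrightarrow> v \<in> pverts G" "(u, v) \<in> parcs G \<Longrightarrow> (v, u) \<in> parcs G"
    "(u, u) \<notin> parcs G"
proof -
  interpret pair_graph G by fact
  show "finite (pverts G)" by (rule pair_finite_verts)
  show "(u, v) \<in> parcs G \<Longrightarrow> u \<in> pverts G" by (rule in_arcsD1)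
  show "(u, v) \<in> parcs G \<Longrightarrow> v \<in> pverts G" by (rule in_arcsD2)
  show "(u, v) \<in> parcs G \<Longrightarrow> (v, u) \<in> parcs G" by (rule arcs_symmetric)
  show "(u, u) \<notin> parcs G" using pair_no_loops by fastforce
qed

lemma induced_subgraph_induced:
  assumes "pair_graph G" "S \<subseteq> pverts G"
  shows "induced_subgraph (with_proj (induced G S)) (with_proj G)"
proof -
  have "pair_wf_digraph (induced G S)" by unfold_locales auto
  moreover have "pair_wf_digraph G"
    using assms(1) by (simp add: pair_graph_def pair_digraph_def pair_fin_digraph_def)
  ultimately show ?thesis
    using assms(2)
    by (auto simp: induced_subgraph_def subgraph_def wf_digraph_wp_iff compatible_def)
qed

lemma recolorings_sym: "(c, d) \<in> (recolorings G C)\<^sup>* \<Longrightarrow> (d, c) \<in> (recolorings G C)\<^sup>*"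
proof -
  have "(d, c) \<in> recolorings G C" if cd: "(c, d) \<in> recolorings G C" for c d
  proof -
    obtain v x where v: "v \<in> pverts G" and d: "d = c(v := x)"
      using cd unfolding recolorings_def by blast
    have "c = d(v := c v)" by (simp add: d)
    then show ?thesis using cd v unfolding recolorings_def by blast
  qed
  then have "sym (recolorings G C)" by (rule symI)
  then show "(c, d) \<in> (recolorings G C)\<^sup>* \<Longrightarrow> (d, c) \<in> (recolorings G C)\<^sup>*"
    by (meson sym_rtrancl symE)
qed

text \<open>One step may be simulated by a whole path: recoloring one vertex of \<open>G - u\<close>
  can cost two steps in \<open>G\<close>.\<close>

lemma rtrancl_image:
  assumes "(a, b) \<in> R\<^sup>*" and "\<And>a b. (a, b) \<in> R \<Longrightarrow> (f a, f b) \<in> Q\<^sup>*"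
  shows "(f a, f b) \<in> Q\<^sup>*"
  using assms(1) by induction (auto intro: rtrancl_trans assms(2))

lemma proper_colorings_restrict:
  assumes "c \<in> proper_colorings G C" "S \<subseteq> pverts G" "c ` S \<subseteq> D"
  shows "restrict c S \<in> proper_colorings (induced G S) D"
  using assms unfolding proper_colorings_def by auto

section \<open>Injective renaming of colors\<close>

lemma proper_colorings_compose:
  assumes "pair_graph G" "c \<in> proper_colorings G C" "inj_on h C" "h ` C \<subseteq> D"
  shows "compose (pverts G) h c \<in> proper_colorings G D"
proof -
  have c: "c v \<in> C" if "v \<in> pverts G" for v
    using assms(2) that by (auto simp: proper_colorings_def)
  have "h (c u) \<noteq> h (c v)" if uv: "(u, v) \<in> parcs G" for u v
  proof -
    have "u \<in> pverts G" "v \<in> pverts G" using pair_graphD(2,3)[OF assms(1)] uv by auto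
    moreover have "c u \<noteq> c v" using assms(2) uv by (auto simp: proper_colorings_def)
    ultimately show ?thesis using inj_onD[OF assms(3)] c by blast
  qed
  moreover have "u \<in> pverts G \<and> v \<in> pverts G" if "(u, v) \<in> parcs G" for u v
    using pair_graphD(2,3)[OF assms(1)] that by auto
  ultimately show ?thesis
    using c assms(4) by (fastforce simp: proper_colorings_def compose_def)
qed

lemma recolorings_compose:
  assumes "pair_graph G" "inj_on h C" "h ` C \<subseteq> D" "(c, d) \<in> (recolorings G C)\<^sup>*"
  shows "(compose (pverts G) h c, compose (pverts G) h d) \<in> (recolorings G D)\<^sup>*"
  using assms(4)
proof (rule rtrancl_image)
  fix c d assume cd: "(c, d) \<in> recolorings G C"
  obtain v x where v: "v \<in> pverts G" and d: "d = c(v := x)"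
    using cd unfolding recolorings_def by blast
  have "compose (pverts G) h d = (compose (pverts G) h c)(v := h x)"
    using v by (auto simp: d compose_def)
  then have "(compose (pverts G) h c, compose (pverts G) h d) \<in> recolorings G D"
    using cd v proper_colorings_compose[OF assms(1) _ assms(2,3)]
    unfolding recolorings_def by blast
  then show "(compose (pverts G) h c, compose (pverts G) h d) \<in> (recolorings G D)\<^sup>*" ..
qed

section \<open>Chromatic number\<close>

lemma colorings_chromatic_number:
  assumes "pair_graph G"
  shows "colorings G (chromatic_number G) \<noteq> {}"
proof -
  let ?n = "card (pverts G)"
  \<comment> \<open>Numbering the vertices gives a coloring with \<open>?n\<close> colors, so the
    \<open>LEAST\<close> in \<open>chromatic_number\<close> is attained.\<close>
  obtain h where h: "bij_betw h (pverts G) {1..?n}"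
    using finite_same_card_bij[OF pair_graphD(1)[OF assms], of "{1..?n}"] by auto
  have "h u \<noteq> h v" if uv: "(u, v) \<in> parcs G" for u v
    using uv pair_graphD(2,3,5)[OF assms] bij_betw_imp_inj_on[OF h]
    by (metis inj_onD)
  moreover have "u \<in> pverts G \<and> v \<in> pverts G" if "(u, v) \<in> parcs G" for u v
    using pair_graphD(2,3)[OF assms] that by auto
  ultimately have "restrict h (pverts G) \<in> colorings G ?n"
    using h by (fastforce simp: colorings_def bij_betw_def)
  then show ?thesis
    unfolding chromatic_number_def by (intro LeastI[of "\<lambda>k. colorings G k \<noteq> {}"]) auto
qed

lemma proper_colorings_nonempty:
  assumes "pair_graph G" "finite C" "chromatic_number G \<le> card C"
  shows "proper_colorings G C \<noteq> {}"
proof -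
  obtain h where h: "inj_on h {1..chromatic_number G}" "h ` {1..chromatic_number G} \<subseteq> C"
    using card_le_inj[of "{1..chromatic_number G}" C] assms(2,3) by auto
  show ?thesis
    using colorings_chromatic_number[OF assms(1)] proper_colorings_compose[OF assms(1) _ h]
    unfolding colorings_eq by blast
qed

lemma chromatic_number_le:
  assumes "pair_graph G" "finite C" "c \<in> proper_colorings G C"
  shows "chromatic_number G \<le> card C"
proof -
  obtain h where h: "bij_betw h C {1..card C}"
    using finite_same_card_bij[OF assms(2), of "{1..card C}"] by auto
  have "colorings G (card C) \<noteq> {}"
    using proper_colorings_compose[OF assms(1,3), of h "{1..card C}"] h
    unfolding colorings_eq bij_betw_def by blast
  then show ?thesis unfolding chromatic_number_def by (rule Least_le)
qed

lemma chromatic_number_le_image: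
  assumes "pair_graph (induced G S)" "finite S" "S \<subseteq> pverts G" "c \<in> proper_colorings G C"
  shows "chromatic_number (induced G S) \<le> card (c ` S)"
  using chromatic_number_le[OF assms(1)] proper_colorings_restrict[OF assms(4,3) subset_refl]
    assms(2) by blast

section \<open>From the recoloring graph to sequences of recolorings\<close>

lemma parcs_recoloring_graph_subset: "parcs (recoloring_graph G l) \<subseteq> recolorings G {1..l}"
proof
  fix p assume p: "p \<in> parcs (recoloring_graph G l)"
  obtain c d where cd: "p = (c, d)" by (cases p)
  with p have P: "c \<in> proper_colorings G {1..l}" "d \<in> proper_colorings G {1..l}"
    and ex: "\<exists>!v. v \<in> pverts G \<and> c v \<noteq> d v"
    by (auto simp: recoloring_graph_def colorings_eq)
  from ex obtain v where v: "v \<in> pverts G" "\<And>w. w \<in> pverts G \<Longrightarrow> w \<noteq> v \<Longrightarrow> c w = d w" by metis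
  \<comment> \<open>On other vertices they agree by uniqueness of \<open>v\<close>; outside the
    graph both are \<open>undefined\<close>.\<close>
  have "d = c(v := d v)"
  proof
    fix w show "d w = (c(v := d v)) w"
      using v(2) proper_coloringsD(2)[OF P(1)] proper_coloringsD(2)[OF P(2)] by (metis fun_upd_apply)
  qed
  then have "\<exists>v \<in> pverts G. \<exists>x. d = c(v := x)" using v(1) by blast
  then show "p \<in> recolorings G {1..l}" using P by (simp add: recolorings_def cd)
qed

lemma recolorings_subset: "recolorings G {1..l} \<subseteq> (parcs (recoloring_graph G l))\<^sup>="
proof
  fix p assume p: "p \<in> recolorings G {1..l}"
  obtain c d where cd: "p = (c, d)" by (cases p)
  with p obtain v x where v: "v \<in> pverts G" and d: "d = c(v := x)"
    unfolding recolorings_def by blast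
  have "c = d \<or> (\<exists>!w. w \<in> pverts G \<and> c w \<noteq> d w)"
    using v by (auto simp: d)
  then show "p \<in> (parcs (recoloring_graph G l))\<^sup>="
    using p by (auto simp: cd recolorings_def recoloring_graph_def colorings_eq)
qed

text \<open>The arcs of the recoloring graph are already symmetric and join colorings only, so
  neither the symmetric closure in \<open>connected\<close> nor the confinement of
  \<open>reachable\<close> to vertices changes the relation.\<close>

lemma reachable_recoloring_graph:
  assumes "c \<in> colorings G l" "d \<in> colorings G l"
  shows "c \<rightarrow>\<^sup>*\<^bsub>with_proj (mk_symmetric (with_proj (recoloring_graph G l)))\<^esub> d
    \<longleftrightarrow> (c, d) \<in> (recolorings G {1..l})\<^sup>*"
proof -
  let ?R = "parcs (recoloring_graph G l)" and ?V = "colorings G l"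
  have "sym ?R"
    unfolding recoloring_graph_def sym_def by (auto simp: eq_commute)
  then have sym: "parcs (mk_symmetric (with_proj (recoloring_graph G l))) = ?R"
    by (auto simp: parcs_mk_symmetric sym_def)
  have V: "pverts (recoloring_graph G l) = ?V" by (simp add: recoloring_graph_def)
  have R: "?R \<subseteq> ?V \<times> ?V" by (auto simp: recoloring_graph_def)
  have on: "(c, d) \<in> rtrancl_on ?V ?R" if "(c, d) \<in> ?R\<^sup>*"
    using that
  proof induction
    case base
    show ?case using assms(1) by (rule rtrancl_on_refl)
  next
    case (step y z)
    then show ?case using R by (blast intro: rtrancl_on_into_rtrancl_on)
  qed
  have "?R\<^sup>* = (recolorings G {1..l})\<^sup>*"
  proof
    show "?R\<^sup>* \<subseteq> (recolorings G {1..l})\<^sup>*"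
      by (rule rtrancl_mono[OF parcs_recoloring_graph_subset])
    show "(recolorings G {1..l})\<^sup>* \<subseteq> ?R\<^sup>*"
      using rtrancl_mono[OF recolorings_subset[of G l]] by simp
  qed
  then show ?thesis
    using on rtrancl_on_rtranclI[of c d ?V ?R] by (auto simp: reachable_def sym V)
qed

lemma recolorable_iff:
  assumes "pair_graph G"
  shows "recolorable G \<longleftrightarrow> (\<forall>l \<ge> chromatic_number G + 1. \<forall>c \<in> proper_colorings G {1..l}.
    \<forall>d \<in> proper_colorings G {1..l}. (c, d) \<in> (recolorings G {1..l})\<^sup>*)"
proof -
  \<comment> \<open>\<open>connected\<close> also demands a non-empty vertex set.\<close>
  have "colorings G l \<noteq> {}" if "l \<ge> chromatic_number G + 1" for l
    using proper_colorings_nonempty[OF assms, of "{1..l}"] that by (simp add: colorings_eq)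
  moreover have "pverts (recoloring_graph G l) = colorings G l" for l
    by (simp add: recoloring_graph_def)
  ultimately show ?thesis
    unfolding colorings_eq[symmetric] recolorable_def connected_def strongly_connected_def
    by (simp add: reachable_recoloring_graph)
qed

text \<open>Rename \<open>C\<close> bijectively to \<open>{1..card C}\<close>, walk there, and
  rename back.\<close>

lemma recolorableD:
  assumes G: "pair_graph G" and rec: "recolorable G"
    and C: "finite C" "chromatic_number G + 1 \<le> card C"
    and c: "c \<in> proper_colorings G C" and d: "d \<in> proper_colorings G C"
  shows "(c, d) \<in> (recolorings G C)\<^sup>*"
proof -
  let ?V = "pverts G" and ?D = "{1..card C}"
  obtain h where h: "bij_betw h C ?D"
    using finite_same_card_bij[OF C(1), of ?D] by auto
  define g where "g = inv_into C h"
  have g: "inj_on g ?D" "g ` ?D \<subseteq> C"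
    using bij_betw_inv_into[OF h] by (auto simp: g_def bij_betw_def)
  have h': "inj_on h C" "h ` C \<subseteq> ?D" using h by (auto simp: bij_betw_def)
  have id: "compose ?V g (compose ?V h e) = e" if e: "e \<in> proper_colorings G C" for e
  proof
    fix v show "compose ?V g (compose ?V h e) v = e v"
      using proper_coloringsD(1,2)[OF e, of v] inv_into_f_f[OF h'(1)]
      by (cases "v \<in> ?V") (simp_all add: compose_def g_def)
  qed
  have "(compose ?V h c, compose ?V h d) \<in> (recolorings G ?D)\<^sup>*"
    using rec proper_colorings_compose[OF G _ h'] c d C(2)
    unfolding recolorable_iff[OF G] by blast
  from recolorings_compose[OF G g this] show ?thesis by (simp add: id c d)
qed

section \<open>Dominated vertices\<close>

text \<open>A coloring of \<open>G - u\<close> extends to \<open>G\<close> by giving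
  \<open>u\<close> the color of \<open>v\<close>, and recoloring sequences lift along this extension
  \<open>f\<close>.\<close>

lemma recolorable_dominated:
  assumes G: "pair_graph G" and u: "u \<in> pverts G" and v: "v \<in> pverts G" and ne: "u \<noteq> v"
    and nadj: "(u, v) \<notin> parcs G"
    and dom: "\<And>w. (u, w) \<in> parcs G \<Longrightarrow> (v, w) \<in> parcs G"
    and H: "pair_graph (induced G (pverts G - {u}))" "recolorable (induced G (pverts G - {u}))"
  shows "recolorable G"
proof -
  let ?H = "induced G (pverts G - {u})"
  define f where "f e = e(u := e v)" for e :: "'a \<Rightarrow> nat"
  have arc: "x \<in> pverts G \<and> y \<in> pverts G \<and> (y, x) \<in> parcs G \<and> x \<noteq> y" if "(x, y) \<in> parcs G" for x y
    using pair_graphD[OF G] that by blast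
  have vu: "(v, u) \<notin> parcs G" using nadj arc by blast
  \<comment> \<open>A color avoided by all neighbors of \<open>v\<close> is avoided by all neighbors
    of \<open>u\<close>. Allowing any such \<open>y\<close>, and not only \<open>e v\<close>, covers
    the moment when \<open>u\<close> still has the old color of \<open>v\<close>.\<close>
  have proper: "e(u := y) \<in> proper_colorings G C"
    if e: "e \<in> proper_colorings ?H C" and y: "y \<in> C" "\<And>w. (v, w) \<in> parcs G \<Longrightarrow> e w \<noteq> y" for e y C
  proof -
    have "(e(u := y)) a \<noteq> (e(u := y)) b" if ab: "(a, b) \<in> parcs G" for a b
    proof (cases "a = u \<or> b = u")
      case True
      then show ?thesis using ab arc[OF ab] dom y(2) by (metis fun_upd_apply)
    next
      case False
      then show ?thesis using ab arc[OF ab] e by (auto simp: proper_colorings_def)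
    qed
    moreover have "e(u := y) \<in> pverts G \<rightarrow>\<^sub>E C"
      using e y(1) u by (auto simp: proper_colorings_def PiE_iff extensional_def)
    ultimately show ?thesis unfolding proper_colorings_def by blast
  qed
  have nbr: "e w \<noteq> e v" "e w \<in> C" if "e \<in> proper_colorings ?H C" "(v, w) \<in> parcs G" for e w C
    using that vu v ne arc[OF that(2)] by (force simp: proper_colorings_def)+
  have mem: "e v \<in> C" if "e \<in> proper_colorings ?H C" for e C
    using that v ne by (auto simp: proper_colorings_def)
  have step: "(f e, f e') \<in> (recolorings G C)\<^sup>*" if ee': "(e, e') \<in> recolorings ?H C" for e e' C
  proof -
    obtain w x where w: "w \<in> pverts G" "w \<noteq> u" and e': "e' = e(w := x)"
      using ee' unfolding recolorings_def by auto
    have P: "e \<in> proper_colorings ?H C" "e' \<in> proper_colorings ?H C"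
      using ee' by (auto simp: recolorings_def)
    have Q: "f e \<in> proper_colorings G C" "f e' \<in> proper_colorings G C"
      unfolding f_def
      by (rule proper[OF P(1) mem[OF P(1)] nbr(1)[OF P(1)]],
        assumption, rule proper[OF P(2) mem[OF P(2)] nbr(1)[OF P(2)]])
    show ?thesis
    proof (cases "w = v")
      case False
      then have "f e' = (f e)(w := x)" using w by (auto simp: f_def e')
      then show ?thesis using Q w unfolding recolorings_def by blast
    next
      case True
      \<comment> \<open>When \<open>v\<close> itself changes, \<open>u\<close> follows one step
        later. In between, \<open>u\<close> keeps the old color \<open>e v\<close>, which the
        unchanged neighbors of \<open>v\<close> still avoid.\<close>
      have M: "e'(u := e v) \<in> proper_colorings G C"
      proof (rule proper[OF P(2) mem[OF P(1)]])
        fix z assume z: "(v, z) \<in> parcs G"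
        then have "z \<noteq> w" using True arc by blast
        then show "e' z \<noteq> e v" using nbr(1)[OF P(1) z] by (simp add: e')
      qed
      have "e'(u := e v) = (f e)(v := x)" using True ne by (auto simp: f_def e')
      then have 1: "(f e, e'(u := e v)) \<in> recolorings G C"
        using Q M v unfolding recolorings_def by blast
      have "f e' = (e'(u := e v))(u := e' v)" by (simp add: f_def)
      then have "(e'(u := e v), f e') \<in> recolorings G C"
        using Q M u unfolding recolorings_def by blast
      with 1 show ?thesis by (meson rtrancl.simps)
    qed
  qed
  have sub: "restrict c (pverts G - {u}) \<in> proper_colorings ?H C" if "c \<in> proper_colorings G C" for c C
    using proper_coloringsD(1)[OF that] by (intro proper_colorings_restrict[OF that]) blast+
  have init: "(c, f (restrict c (pverts G - {u}))) \<in> (recolorings G C)\<^sup>*"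
    if c: "c \<in> proper_colorings G C" for c C
  proof -
    let ?e = "restrict c (pverts G - {u})"
    have "f ?e = c(u := c v)"
    proof
      fix z show "f ?e z = (c(u := c v)) z"
        using v ne proper_coloringsD(2)[OF c, of z] by (cases "z \<in> pverts G") (simp_all add: f_def)
    qed
    moreover have "f ?e \<in> proper_colorings G C"
      unfolding f_def
      by (rule proper[OF sub[OF c] mem[OF sub[OF c]] nbr(1)[OF sub[OF c]]])
    ultimately have "(c, f ?e) \<in> recolorings G C"
      using c u unfolding recolorings_def by blast
    then show ?thesis ..
  qed
  \<comment> \<open>Hence a number of colors exceeding the chromatic number of \<open>G\<close> also
    exceeds that of \<open>G - u\<close>.\<close>
  have chi: "chromatic_number ?H \<le> chromatic_number G"
  proof -
    obtain c where "c \<in> proper_colorings G {1..chromatic_number G}"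
      using colorings_chromatic_number[OF G] by (auto simp: colorings_eq)
    from chromatic_number_le[OF H(1) _ sub[OF this]] show ?thesis by simp
  qed
  show ?thesis
    unfolding recolorable_iff[OF G]
  proof (intro allI impI ballI)
    fix l c d
    assume l: "chromatic_number G + 1 \<le> l"
      and c: "c \<in> proper_colorings G {1..l}" and d: "d \<in> proper_colorings G {1..l}"
    have "(restrict c (pverts G - {u}), restrict d (pverts G - {u})) \<in> (recolorings ?H {1..l})\<^sup>*"
      using l chi by (intro recolorableD[OF H] sub c d) auto
    then have "(f (restrict c (pverts G - {u})), f (restrict d (pverts G - {u})))
        \<in> (recolorings G {1..l})\<^sup>*"
      by (rule rtrancl_image) (rule step)
    then show "(c, d) \<in> (recolorings G {1..l})\<^sup>*"
      by (meson init[OF c] recolorings_sym[OF init[OF d]] rtrancl_trans)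
  qed
qed

section \<open>Joins\<close>

definition is_join :: "'a pair_pre_digraph \<Rightarrow> 'a set \<Rightarrow> 'a set \<Rightarrow> bool" where
  "is_join G S B \<longleftrightarrow> pverts G = S \<union> B \<and> S \<inter> B = {} \<and>
     (\<forall>s \<in> S. \<forall>b \<in> B. (s, b) \<in> parcs G \<and> (b, s) \<in> parcs G)"

lemma is_join_commute: "is_join G S B \<Longrightarrow> is_join G B S"
  unfolding is_join_def by blast

lemma is_join_disjoint_colors:
  assumes "is_join G S B" "c \<in> proper_colorings G C"
  shows "c ` S \<inter> c ` B = {}"
  using assms by (fastforce simp: is_join_def proper_colorings_def)

text \<open>Edges inside \<open>S\<close> are settled by \<open>e\<close>, edges inside
  \<open>B\<close> by \<open>c\<close>, and edges between them because \<open>B\<close> avoids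
  \<open>D\<close>.\<close>

lemma override_on_join_proper:
  assumes G: "pair_graph G" and j: "is_join G S B" and c: "c \<in> proper_colorings G C"
    and D: "D \<subseteq> C" "c ` B \<inter> D = {}" and e: "e \<in> proper_colorings (induced G S) D"
  shows "override_on c e S \<in> proper_colorings G C"
proof -
  have "override_on c e S a \<noteq> override_on c e S b" if ab: "(a, b) \<in> parcs G" for a b
  proof -
    have V: "a \<in> S \<union> B" "b \<in> S \<union> B" using pair_graphD(2,3)[OF G ab] j by (auto simp: is_join_def)
    have E: "e x \<in> D" if "x \<in> S" for x using e that by (auto simp: proper_colorings_def)
    have "e a \<noteq> e b" if "a \<in> S" "b \<in> S" using e ab that by (auto simp: proper_colorings_def)
    moreover have "c a \<noteq> c b" using c ab by (auto simp: proper_colorings_def)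
    ultimately show ?thesis
      using V E D(2) unfolding override_on_def disjoint_iff by (metis UnE image_eqI)
  qed
  moreover have "override_on c e S \<in> pverts G \<rightarrow>\<^sub>E C"
    using c e D(1) j
    by (auto simp: proper_colorings_def PiE_iff extensional_def override_on_def is_join_def)
  ultimately show ?thesis unfolding proper_colorings_def by blast
qed

text \<open>\<open>B\<close> stays fixed while \<open>S\<close> moves inside \<open>D\<close>, which
  has a color beyond the chromatic number of \<open>S\<close>; so recolorability of \<open>S\<close>
  supplies the path.\<close>

lemma join_recolor_side:
  assumes G: "pair_graph G" and j: "is_join G S B"
    and H: "pair_graph (induced G S)" "recolorable (induced G S)"
    and C: "finite C" and c: "c \<in> proper_colorings G C"
    and D: "D \<subseteq> C" "c ` S \<subseteq> D" "c ` B \<inter> D = {}" "chromatic_number (induced G S) + 1 \<le> card D"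
    and e: "e \<in> proper_colorings (induced G S) D"
  shows "(c, override_on c e S) \<in> (recolorings G C)\<^sup>*"
proof -
  let ?c = "restrict c S"
  have "?c \<in> proper_colorings (induced G S) D"
    using j by (intro proper_colorings_restrict[OF c _ D(2)]) (auto simp: is_join_def)
  then have "(?c, e) \<in> (recolorings (induced G S) D)\<^sup>*"
    using recolorableD[OF H _ D(4) _ e] finite_subset[OF D(1) C] by blast
  then have "(override_on c ?c S, override_on c e S) \<in> (recolorings G C)\<^sup>*"
  proof (rule rtrancl_image)
    fix a b assume ab: "(a, b) \<in> recolorings (induced G S) D"
    then obtain v x where v: "v \<in> S" and b: "b = a(v := x)"
      unfolding recolorings_def by auto
    have "override_on c b S = (override_on c a S)(v := x)"
      using v by (auto simp: b override_on_def)
    moreover have "override_on c a S \<in> proper_colorings G C" "override_on c b S \<in> proper_colorings G C"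
      using ab override_on_join_proper[OF G j c D(1,3)] by (auto simp: recolorings_def)
    moreover have "v \<in> pverts G" using v j by (simp add: is_join_def)
    ultimately have "(override_on c a S, override_on c b S) \<in> recolorings G C"
      unfolding recolorings_def by blast
    then show "(override_on c a S, override_on c b S) \<in> (recolorings G C)\<^sup>*" ..
  qed
  moreover have "override_on c ?c S = c" by (auto simp: override_on_def)
  ultimately show ?thesis by simp
qed

lemma override_on_image:
  assumes "S \<inter> B = {}"
  shows "override_on c e S ` S = e ` S" "override_on c e S ` B = c ` B"
proof -
  show "override_on c e S ` S = e ` S" by (rule image_cong) auto
  show "override_on c e S ` B = c ` B" using assms by (intro image_cong) (auto simp: override_on_def)
qed

lemma join_recolor_into:
  assumes G: "pair_graph G" and j: "is_join G S B"
    and H: "pair_graph (induced G S)" "recolorable (induced G S)"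
    and C: "finite C" and c: "c \<in> proper_colorings G C"
    and D: "D \<subseteq> C" "c ` S \<subseteq> D" "c ` B \<inter> D = {}" "chromatic_number (induced G S) + 1 \<le> card D"
    and A: "A \<subseteq> D" "card A = chromatic_number (induced G S)"
  shows "\<exists>d \<in> proper_colorings G C. (c, d) \<in> (recolorings G C)\<^sup>* \<and> d ` S = A \<and> d ` B = c ` B"
proof -
  have finA: "finite A" using A(1) D(1) C by (meson finite_subset)
  obtain e where e: "e \<in> proper_colorings (induced G S) A"
    using proper_colorings_nonempty[OF H(1) finA] A(2) by auto
  have eS: "e ` S \<subseteq> A" using e by (auto simp: proper_colorings_def)
  \<comment> \<open>Viewed as a coloring by its own image, \<open>e\<close> needs at least
    \<open>card A\<close> colors, so it misses none of \<open>A\<close>.\<close>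
  have "e \<in> proper_colorings (induced G S) (e ` S)" using e by (auto simp: proper_colorings_def)
  then have "card A \<le> card (e ` S)"
    using chromatic_number_le[OF H(1)] finite_subset[OF eS finA] A(2) by metis
  then have eA: "e ` S = A" using eS finA by (simp add: card_seteq)
  have e': "e \<in> proper_colorings (induced G S) D"
    using e A(1) by (auto simp: proper_colorings_def)
  have SB: "S \<inter> B = {}" using j by (simp add: is_join_def)
  show ?thesis
    using override_on_join_proper[OF G j c D(1,3) e'] join_recolor_side[OF G j H C c D e']
      override_on_image[OF SB, of c e] eA by blast
qed

text \<open>Every coloring is driven to one fixed coloring \<open>k\<close> in three phases: reduce
  \<open>S\<close> to as few colors as possible, exchange these for a fixed set \<open>T\<close>,
  then bring \<open>B\<close> and \<open>S\<close> to fixed colorings.\<close>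

lemma recolorable_join:
  assumes G: "pair_graph G" and j: "is_join G S B"
    and S: "pair_graph (induced G S)" "recolorable (induced G S)"
    and B: "pair_graph (induced G B)" "recolorable (induced G B)"
  shows "recolorable G"
proof -
  let ?m = "chromatic_number (induced G S)" and ?n = "chromatic_number (induced G B)"
  note j' = is_join_commute[OF j]
  have V: "S \<subseteq> pverts G" "B \<subseteq> pverts G" "pverts G = S \<union> B" "S \<inter> B = {}"
    using j by (auto simp: is_join_def)
  have fin: "finite S" "finite B" using pair_graphD(1)[OF G] V by auto
  have chi: "?m + ?n \<le> chromatic_number G"
  proof -
    obtain c where c: "c \<in> proper_colorings G {1..chromatic_number G}"
      using colorings_chromatic_number[OF G] by (auto simp: colorings_eq)
    have "?m + ?n \<le> card (c ` S) + card (c ` B)"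
      using chromatic_number_le_image[OF S(1) fin(1) V(1) c]
        chromatic_number_le_image[OF B(1) fin(2) V(2) c] by simp
    also have "\<dots> = card (c ` S \<union> c ` B)"
      using fin is_join_disjoint_colors[OF j c] by (simp add: card_Un_disjoint)
    also have "\<dots> \<le> card {1..chromatic_number G}"
      using proper_coloringsD(1)[OF c] V(1,2) by (intro card_mono) auto
    finally show ?thesis by simp
  qed
  show ?thesis
    unfolding recolorable_iff[OF G]
  proof (intro allI impI ballI)
    fix l c0 d0
    assume l: "chromatic_number G + 1 \<le> l"
      and c0: "c0 \<in> proper_colorings G {1..l}" and d0: "d0 \<in> proper_colorings G {1..l}"
    let ?C = "{1..l}"
    let ?R = "(recolorings G ?C)\<^sup>*"
    have C: "finite ?C" "card ?C \<ge> ?m + ?n + 1" using l chi by auto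
    have sub: "c ` S \<subseteq> ?C" "c ` B \<subseteq> ?C" if "c \<in> proper_colorings G ?C" for c
      using proper_coloringsD(1)[OF that] V(1,2) by auto
    \<comment> \<open>If more than \<open>?m\<close> colors are absent from \<open>B\<close>, then
      \<open>S\<close> can be moved onto \<open>?m\<close> of them; otherwise \<open>S\<close>
      already uses at most, hence exactly, \<open>?m\<close> colors.\<close>
    have normalize: "\<exists>d \<in> proper_colorings G ?C. (c, d) \<in> ?R \<and> card (d ` S) = ?m"
      if c: "c \<in> proper_colorings G ?C" for c
    proof (cases "?m + 1 \<le> card (?C - c ` B)")
      case True
      obtain A where A: "A \<subseteq> ?C - c ` B" "card A = ?m"
        by (rule obtain_subset_with_card_n[OF add_leD1[OF True]])
      have "c ` S \<subseteq> ?C - c ` B" using sub[OF c] is_join_disjoint_colors[OF j c] by blast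
      from join_recolor_into[OF G j S C(1) c Diff_subset this _ True A]
      show ?thesis using A(2) by blast
    next
      case False
      have "c ` S \<subseteq> ?C - c ` B" using sub[OF c] is_join_disjoint_colors[OF j c] by blast
      then have "card (c ` S) \<le> card (?C - c ` B)" by (intro card_mono) auto
      then have "card (c ` S) = ?m"
        using False chromatic_number_le_image[OF S(1) fin(1) V(1) c] by linarith
      then show ?thesis using c by blast
    qed
    obtain T where T: "T \<subseteq> ?C" "card T = ?m"
    proof (rule obtain_subset_with_card_n)
      show "?m \<le> card ?C" using C(2) by linarith
    qed
    have finT: "finite T" using T(1) by (rule finite_subset) simp
    \<comment> \<open>Induction on the number of colors of \<open>T\<close> missing on
      \<open>S\<close>. Each round clears a missing color \<open>t\<close> from \<open>B\<close> and
      trades a color \<open>s\<close> outside \<open>T\<close> for it on \<open>S\<close>.\<close>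
    have exchange: "\<exists>d \<in> proper_colorings G ?C. (c, d) \<in> ?R \<and> d ` S = T"
      if "c \<in> proper_colorings G ?C" "card (c ` S) = ?m" for c
      using that
    proof (induction "card (T - c ` S)" arbitrary: c rule: less_induct)
      case less
      note c = less.prems(1)
      show ?case
      proof (cases "T \<subseteq> c ` S")
        case True
        then have "c ` S = T" using less.prems(2) T(2) fin(1) by (metis card_subset_eq finite_imageI)
        then show ?thesis using c by blast
      next
        case False
        then obtain t where t: "t \<in> T" "t \<notin> c ` S" by blast
        have "\<not> c ` S \<subseteq> T"
          using t less.prems(2) T(2) finT by (metis card_subset_eq)
        then obtain s where s: "s \<in> c ` S" "s \<notin> T" by blast
        have cardD: "card (?C - c ` S) = l - ?m"
          using sub(1)[OF c] less.prems(2) by (simp add: card_Diff_subset fin(1))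
        \<comment> \<open>The surplus color gives \<open>B\<close> at least \<open>?n + 1\<close>
          colors to move in, and without \<open>t\<close> there remain \<open>?n\<close> to land
          on.\<close>
        have n1: "?n + 1 \<le> card (?C - c ` S)" using cardD C(2) by simp
        have "card (?C - c ` S - {t}) = l - ?m - 1"
          using cardD t T(1) by (subst card_Diff_singleton) auto
        then have "?n \<le> card (?C - c ` S - {t})" using C(2) by simp
        then obtain A where A: "A \<subseteq> ?C - c ` S - {t}" "card A = ?n"
          by (rule obtain_subset_with_card_n)
        have AD: "A \<subseteq> ?C - c ` S" "c ` S \<inter> (?C - c ` S) = {}" using A(1) by blast+
        have "c ` B \<subseteq> ?C - c ` S" using sub[OF c] is_join_disjoint_colors[OF j c] by blast
        from join_recolor_into[OF G j' B C(1) c Diff_subset this AD(2) n1 AD(1) A(2)]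
        obtain d where d: "d \<in> proper_colorings G ?C" "(c, d) \<in> ?R" "d ` B = A" "d ` S = c ` S"
          by blast
        \<comment> \<open>With \<open>t\<close> gone from \<open>B\<close>, \<open>S\<close> has
          \<open>?m + 1\<close> colors to move in and lands on its old ones with \<open>s\<close>
          replaced by \<open>t\<close>.\<close>
        let ?D = "insert t (c ` S)" and ?A = "insert t (c ` S - {s})"
        have D: "?D \<subseteq> ?C" "d ` S \<subseteq> ?D" "d ` B \<inter> ?D = {}" "?m + 1 \<le> card ?D" "?A \<subseteq> ?D" "card ?A = ?m"
          using sub(1)[OF c] t T(1) d A(1) s(1) less.prems(2) fin(1) card_Suc_Diff1[of "c ` S" s]
          by auto
        obtain d' where d': "d' \<in> proper_colorings G ?C" "(d, d') \<in> ?R" "d' ` S = ?A"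
          using join_recolor_into[OF G j S C(1) d(1) D] by metis
        have "T - d' ` S \<subset> T - c ` S" using t s d'(3) by auto
        then have "card (T - d' ` S) < card (T - c ` S)" using finT by (intro psubset_card_mono) auto
        then obtain d'' where d'': "d'' \<in> proper_colorings G ?C" "(d', d'') \<in> ?R" "d'' ` S = T"
          using less.hyps[OF _ d'(1)] d'(3) D(6) by auto
        have "(c, d'') \<in> ?R" by (rule rtrancl_trans[OF d(2) rtrancl_trans[OF d'(2) d''(2)]])
        then show ?thesis using d'' by blast
      qed
    qed
    have CT: "?n + 1 \<le> card (?C - T)"
      using T C(2) by (simp add: card_Diff_subset finT)
    obtain U where U: "U \<subseteq> ?C - T" "card U = ?n"
      by (rule obtain_subset_with_card_n[OF add_leD1[OF CT]])
    have finU: "finite U" using U(1) by (rule finite_subset) simp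
    obtain p where p: "p \<in> proper_colorings (induced G S) T"
      using proper_colorings_nonempty[OF S(1) finT] T(2) by auto
    obtain q where q: "q \<in> proper_colorings (induced G B) U"
      using proper_colorings_nonempty[OF B(1) finU] U(2) by auto
    \<comment> \<open>With \<open>S\<close> on \<open>T\<close>, the complement of \<open>T\<close>
      has room for \<open>B\<close> to move to \<open>q\<close>; then \<open>B\<close> uses only
      colors of \<open>U\<close>, and the complement of \<open>U\<close> has room for
      \<open>S\<close> to move to \<open>p\<close>.\<close>
    have canonical: "(c, override_on (override_on c q B) p S) \<in> ?R"
      if c: "c \<in> proper_colorings G ?C" and cT: "c ` S = T" for c
    proof -
      let ?d = "override_on c q B"
      have q': "q \<in> proper_colorings (induced G B) (?C - T)"
        using q U(1) by (auto simp: proper_colorings_def)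
      have cB: "c ` B \<subseteq> ?C - T" "c ` S \<inter> (?C - T) = {}"
        using sub[OF c] is_join_disjoint_colors[OF j c] cT by blast+
      have d: "?d \<in> proper_colorings G ?C"
        by (rule override_on_join_proper[OF G j' c Diff_subset cB(2) q'])
      have 1: "(c, ?d) \<in> ?R"
        by (rule join_recolor_side[OF G j' B C(1) c Diff_subset cB CT q'])
      have im: "?d ` S = T" "?d ` B \<subseteq> U"
        using override_on_image[of B S c q] V(4) cT q by (auto simp: proper_colorings_def)
      have p': "p \<in> proper_colorings (induced G S) (?C - U)"
        using p U(1) T(1) by (fastforce simp: proper_colorings_def)
      have "(?d, override_on ?d p S) \<in> ?R"
      proof (rule join_recolor_side[OF G j S C(1) d Diff_subset _ _ _ p'])
        show "?d ` S \<subseteq> ?C - U" "?d ` B \<inter> (?C - U) = {}" using im T(1) U(1) by auto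
        show "?m + 1 \<le> card (?C - U)"
          using U C(2) by (subst card_Diff_subset) (auto simp: finU)
      qed
      with 1 show ?thesis by (rule rtrancl_trans)
    qed
    \<comment> \<open>Every coloring is \<open>undefined\<close> outside the graph, and
      \<open>q\<close> and \<open>p\<close> overwrite all values inside, so \<open>canonical\<close>
      ends in \<open>k\<close> from any start.\<close>
    define k where "k = override_on (override_on (\<lambda>_. undefined) q B) p S"
    have to_k: "(c, k) \<in> ?R" if c: "c \<in> proper_colorings G ?C" for c
    proof -
      obtain d where d: "d \<in> proper_colorings G ?C" "(c, d) \<in> ?R" "card (d ` S) = ?m"
        using normalize[OF c] by blast
      obtain e where e: "e \<in> proper_colorings G ?C" "(d, e) \<in> ?R" "e ` S = T"
        using exchange[OF d(1,3)] by blast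
      have "override_on (override_on e q B) p S = k"
        using e(1) V(3)
        by (auto simp: k_def override_on_def proper_colorings_def PiE_iff extensional_def)
      with canonical[OF e(1,3)] show ?thesis using d(2) e(2) by (metis rtrancl_trans)
    qed
    show "(c0, d0) \<in> ?R" by (meson to_k[OF c0] recolorings_sym[OF to_k[OF d0]] rtrancl_trans)
  qed
qed

section \<open>Modules in graphs without induced \<open>2K\<^sub>2\<close>\<close>

text \<open>The four vertices are automatically distinct: if the two edges shared a vertex, one of
  the excluded arcs would be the edge \<open>(x, y)\<close> or its reverse.\<close>

lemma two_K2_freeD:
  assumes G: "pair_graph G" "two_K2_free G"
    and ab: "(a, b) \<in> parcs G" and xy: "(x, y) \<in> parcs G"
    and nadj: "(a, x) \<notin> parcs G" "(a, y) \<notin> parcs G" "(b, x) \<notin> parcs G" "(b, y) \<notin> parcs G"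
  shows False
proof -
  let ?H = "induced G {a, b, x, y}"
  note g = pair_graphD[OF G(1)]
  have nadj': "(x, a) \<notin> parcs G" "(y, a) \<notin> parcs G" "(x, b) \<notin> parcs G" "(y, b) \<notin> parcs G"
    using nadj g(4) by blast+
  have ne: "a \<noteq> b" "x \<noteq> y" "a \<noteq> x" "a \<noteq> y" "b \<noteq> x" "b \<noteq> y"
    using ab xy nadj nadj' g(5) by auto
  have sub: "{a, b, x, y} \<subseteq> pverts G" using g(2,3) ab xy by blast
  have arcs: "parcs ?H = {(a, b), (b, a), (x, y), (y, x)}"
    using ab xy nadj nadj' g(4)[OF ab] g(4)[OF xy] g(5) by auto
  define f :: "nat \<Rightarrow> 'a" where "f i = [a, b, x, y] ! i" for i
  have f: "f 0 = a" "f 1 = b" "f 2 = x" "f 3 = y" "f (Suc 0) = b"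
    by (simp_all add: f_def eval_nat_numeral)
  let ?i = "\<lparr>iso_verts = f, iso_arcs = map_prod f f, iso_head = snd, iso_tail = fst\<rparr>"
  have "pair_wf_digraph two_K2" by unfold_locales (auto simp: two_K2_def)
  then have "pre_digraph.digraph_isomorphism (with_proj two_K2) ?i"
    using ne
    by (auto simp: pre_digraph.digraph_isomorphism_def wf_digraph_wp_iff two_K2_def inj_on_def f)
  moreover have "with_proj ?H = app_iso ?i (with_proj two_K2)"
    by (simp add: app_iso_def with_proj_def arcs del: induced_simps(2))
      (simp add: two_K2_def f)
  ultimately have "digraph_iso (with_proj two_K2) (with_proj ?H)"
    unfolding digraph_iso_def by blast
  then show False
    using G(2) induced_subgraph_induced[OF G(1) sub] unfolding two_K2_free_def by blast
qed

text \<open>\<open>undom\<close> says that no pair as in \<open>recolorable_dominated\<close>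
  exists.\<close>

lemma nontrivial_module_join:
  assumes G: "pair_graph G" "two_K2_free G" and M: "nontrivial_module G S"
    and undom: "\<And>u v. u \<in> pverts G \<Longrightarrow> v \<in> pverts G \<Longrightarrow> u \<noteq> v \<Longrightarrow> (u, v) \<notin> parcs G \<Longrightarrow>
      \<exists>w. (u, w) \<in> parcs G \<and> (v, w) \<notin> parcs G"
  shows "is_join G S (pverts G - S)"
proof -
  note g = pair_graphD[OF G(1)]
  have S: "S \<subseteq> pverts G" "card S \<ge> 2"
    and mod: "\<And>v s t. v \<in> pverts G \<Longrightarrow> v \<notin> S \<Longrightarrow> s \<in> S \<Longrightarrow> t \<in> S \<Longrightarrow> (v, s) \<in> parcs G \<Longrightarrow> (v, t) \<in> parcs G"
    using M unfolding nontrivial_module_def is_module_def by auto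
  obtain s t where st: "s \<in> S" "t \<in> S" "s \<noteq> t"
    using S(2) by (metis One_nat_def card_le_Suc0_iff_eq card.infinite not_less_eq_eq numeral_2_eq_2 zero_le)
  have "\<exists>x y. x \<in> S \<and> y \<in> S \<and> (x, y) \<in> parcs G"
  proof (rule ccontr)
    assume indep: "\<not> ?thesis"
    \<comment> \<open>By independence \<open>w\<close> lies outside \<open>S\<close>, but the module
      property forbids an outside vertex to distinguish \<open>s\<close> from
      \<open>t\<close>.\<close>
    then obtain w where "(s, w) \<in> parcs G" "(t, w) \<notin> parcs G"
      using undom[of s t] st S(1) by blast
    moreover from this have "w \<notin> S" using indep st by blast
    ultimately show False using mod[of w s t] st g(3,4) by blast
  qed
  then obtain x y where xy: "x \<in> S" "y \<in> S" "(x, y) \<in> parcs G" by blast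
  have "(b, x) \<in> parcs G" if b: "b \<in> pverts G" "b \<notin> S" for b
  proof (rule ccontr)
    assume bx: "(b, x) \<notin> parcs G"
    \<comment> \<open>The module property puts \<open>w\<close> outside \<open>S\<close> and makes
      \<open>b\<close> and \<open>w\<close> non-adjacent to \<open>y\<close> as well as to
      \<open>x\<close>, so the edges \<open>(b, w)\<close> and \<open>(x, y)\<close> induce a
      \<open>2K_2\<close>.\<close>
    then obtain w where w: "(b, w) \<in> parcs G" "(x, w) \<notin> parcs G"
      using undom[of b x] b xy(1) S(1) by blast
    have by': "(b, y) \<notin> parcs G" using bx mod[OF b xy(2,1)] by blast
    have wS: "w \<notin> S" using mod[OF b _ xy(1)] w(1) bx by blast
    have wx: "(w, x) \<notin> parcs G" using w(2) g(4) by blast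
    have "(w, y) \<notin> parcs G" using wx mod[OF _ wS xy(2,1)] w(1) g(3) by blast
    then show False using two_K2_freeD[OF G w(1) xy(3) bx by' wx] by blast
  qed
  then have "(b, z) \<in> parcs G \<and> (z, b) \<in> parcs G" if "b \<in> pverts G" "b \<notin> S" "z \<in> S" for b z
    using that mod[of b x z] xy(1) g(4) by blast
  then show ?thesis using S(1) by (auto simp: is_join_def)
qed

section \<open>Induction on the number of vertices\<close>

theorem theorem11:
  fixes \<G> :: "'a pair_pre_digraph set"
  assumes "\<forall>G \<in> \<G>. pair_graph G"
    and "hereditary \<G>"
    and "\<forall>G \<in> \<G>. two_K2_free G"
    and "\<forall>G \<in> \<G>. prime_graph G \<longrightarrow> recolorable G"
  shows "\<forall>G \<in> \<G>. recolorable G"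
proof
  fix G assume "G \<in> \<G>"
  then show "recolorable G"
  proof (induction "card (pverts G)" arbitrary: G rule: less_induct)
    case less
    have G: "pair_graph G" "two_K2_free G" using assms less.prems by auto
    have fin: "finite (pverts G)" by (rule pair_graphD[OF G(1)])
    \<comment> \<open>Heredity keeps proper induced subgraphs in the class, so the induction
      hypothesis covers both \<open>G - u\<close> and the two sides of a join.\<close>
    have ind: "pair_graph (induced G S)" "recolorable (induced G S)" if S: "S \<subset> pverts G" for S
    proof -
      have "induced_subgraph (with_proj (induced G S)) (with_proj G)"
        using S by (intro induced_subgraph_induced[OF G(1)]) auto
      then have "induced G S \<in> \<G>" using assms(2) less.prems unfolding hereditary_def by blast
      then show "pair_graph (induced G S)" "recolorable (induced G S)"
        using assms(1) less.hyps psubset_card_mono[OF fin S] by auto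
    qed
    show ?case
    proof (cases "prime_graph G")
      case True
      then show ?thesis using assms(4) less.prems by blast
    next
      case False
      then obtain S where S: "nontrivial_module G S" unfolding prime_graph_def by blast
      have parts: "S \<subset> pverts G" "pverts G - S \<subset> pverts G"
        using S unfolding nontrivial_module_def is_module_def by auto
      show ?thesis
      \<comment> \<open>If \<open>G\<close> is not recolorable, \<open>recolorable_dominated\<close>
        excludes every dominated pair, which is the hypothesis \<open>undom\<close> of
        \<open>nontrivial_module_join\<close>.\<close>
      proof (rule ccontr)
        assume nrec: "\<not> recolorable G"
        have "is_join G S (pverts G - S)"
        proof (rule nontrivial_module_join[OF G S], rule ccontr)
          fix u v
          assume uv: "u \<in> pverts G" "v \<in> pverts G" "u \<noteq> v" "(u, v) \<notin> parcs G"
            and dom: "\<nexists>w. (u, w) \<in> parcs G \<and> (v, w) \<notin> parcs G"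
          have "pverts G - {u} \<subset> pverts G" using uv(1) by blast
          then have "recolorable G"
            using recolorable_dominated[OF G(1) uv] ind dom by blast
          then show False using nrec by contradiction
        qed
        from recolorable_join[OF G(1) this ind[OF parts(1)] ind[OF parts(2)]] nrec
        show False by contradiction
      qed
    qed
  qed
qed

end
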